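(* Let $f_n\in\mathcal{W}$ ($n\in\mathbb{N}$) and $f\in\mathcal{W}$. Then the following are equivalent: (i) $f_n$ converges almost basically to $f$ as $n\to\infty$. (ii) $f_n$ converges to $f$ locally in Lebesgue measure up to constants, i.e. there exists a sequence $(c_n)_{n\in\mathbb{N}}$ of real numbers such that for all $\varepsilon>0$ and $r>0$ $$\lim_{n\to\infty}\lambda\left(\{x\in[-r,r]:|f_n(x)-c_n-f(x)|>\varepsilon\}\right)=0.$$ (iii) There exists a sequence $(c_n)_{n\in\mathbb{N}}$ of real numbers such that for each subsequence $(f_{n_k})_{k\in\mathbb{N}}$ of $(f_n)_{n\in\mathbb{N}}$ there exist a further subsequence $(f_{n_{k_l}})_{l\in\mathbb{N}}$ and a Borel set $S$ of Lebesgue measure zero such that $f_{n_{k_l}}(x)-c_{n_{k_l}}\to f(x)$ as $l\to\infty$ for all $x\in\mathbb{R}\setminus S$.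
   Context: $\lambda$ is Lebesgue measure on $\mathbb{R}$. $\mathcal{W}$ is the set of right-continuous functions $f:\mathbb{R}\to\mathbb{R}$ of bounded variation (i.e. $\lim_{n\to\infty}TV_{[-n,n]}f<\infty$, where $TV_{[a,b]}f$ is the total variation of $f$ on $[a,b]$) with $\lim_{x\to-\infty}f(x)=0$. Functions $f_n:\mathbb{R}\to\mathbb{R}$ converge almost basically to $f:\mathbb{R}\to\mathbb{R}$ if every subsequence $(f_{n_k})_{k}$ contains a further subsequence $(f_{n_{k_l}})_{l}$ and there is a set $S\subset\mathbb{R}$ of Lebesgue measure zero (which may depend on the subsequence) such that $f_{n_{k_l}}(x_1)-f_{n_{k_l}}(x_2)\to f(x_1)-f(x_2)$ as $l\to\infty$ for all $x_1,x_2\in\mathbb{R}\setminus S$. *)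

theory Defs
  imports "HOL-Analysis.Analysis"
begin

text \<open>Supremum over all partitions \<open>a = t 0 < t 1 < \<dots> < t n = b\<close>; meant for \<open>a \<le> b\<close>.
  It is extended-real valued, so infinite variation is represented by \<open>\<infinity>\<close>.\<close>

definition total_variation :: "real \<Rightarrow> real \<Rightarrow> (real \<Rightarrow> real) \<Rightarrow> ennreal" where
  "total_variation a b f =
     (SUP (n, t) \<in> {(n :: nat, t :: nat \<Rightarrow> real). t 0 = a \<and> t n = b \<and> (\<forall>i<n. t i < t (Suc i))}.
        \<Sum>i<n. ennreal \<bar>f (t (Suc i)) - f (t i)\<bar>)"

definition bounded_variation :: "(real \<Rightarrow> real) \<Rightarrow> bool" where
  "bounded_variation f \<longleftrightarrow>
     (\<exists>V::ennreal. (\<lambda>n::nat. total_variation (- real n) (real n) f) \<longlonglongrightarrow> V \<and> V < \<infinity>)"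

definition \<W> :: "(real \<Rightarrow> real) set" where
  "\<W> = {f. (\<forall>x. continuous (at_right x) f) \<and> bounded_variation f \<and> (f \<longlongrightarrow> 0) at_bot}"

text \<open>A subsequence is given by a strictly increasing index map; below, \<open>k\<close> selects the
  subsequence and \<open>l\<close> the further subsequence, whose \<open>j\<close>-th term has index \<open>k (l j)\<close>.\<close>

definition converges_almost_basically ::
    "(nat \<Rightarrow> real \<Rightarrow> real) \<Rightarrow> (real \<Rightarrow> real) \<Rightarrow> bool" where
  "converges_almost_basically fs f \<longleftrightarrow>
     (\<forall>k::nat \<Rightarrow> nat. strict_mono k \<longrightarrow>
       (\<exists>l::nat \<Rightarrow> nat. strict_mono l \<and>
         (\<exists>S \<in> null_sets lebesgue. \<forall>x\<^sub>1 \<in> - S. \<forall>x\<^sub>2 \<in> - S.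
           (\<lambda>j. fs (k (l j)) x\<^sub>1 - fs (k (l j)) x\<^sub>2) \<longlonglongrightarrow> f x\<^sub>1 - f x\<^sub>2)))"

definition converges_locally_in_measure_upto_constants ::
    "(nat \<Rightarrow> real \<Rightarrow> real) \<Rightarrow> (real \<Rightarrow> real) \<Rightarrow> bool" where
  "converges_locally_in_measure_upto_constants fs f \<longleftrightarrow>
     (\<exists>c::nat \<Rightarrow> real. \<forall>\<epsilon>>0. \<forall>r>0.
       (\<lambda>n. emeasure lebesgue {x \<in> {-r..r}. \<bar>fs n x - c n - f x\<bar> > \<epsilon>}) \<longlonglongrightarrow> 0)"

end

theory Submission
  imports Defs "HOL-Probability.Distributions"
begin

text \<open>
  Everything is expressed through the functional \<open>\<rho> g = \<integral> min 1 \<bar>g\<bar> d\<gamma>\<close>, where \<open>\<gamma>\<close> is the standard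
  Gaussian measure: for Borel functions, \<open>\<rho> (g n) \<longlonglongrightarrow> 0\<close> is the same as convergence of \<open>g n\<close> to \<open>0\<close>
  locally in Lebesgue measure, it follows from almost everywhere convergence, and it yields almost
  everywhere convergence of a subsequence. The only point that needs an idea is the choice of the
  constants \<open>c n\<close> independently of the subsequence in (i): take \<open>c n\<close> to minimise
  \<open>c \<mapsto> \<rho> (f n - f - c)\<close> up to an error \<open>1 / (n + 1)\<close>. Along a subsequence as in (i), the competitor
  \<open>f n x0 - f x0\<close> for a fixed \<open>x0\<close> outside the exceptional set makes \<open>\<rho>\<close> tend to \<open>0\<close>, hence so does
  the near-minimiser.
\<close>

section \<open>Measurability and the subsequence principle\<close>

text \<open>Sampling \<open>f\<close> at the next point of a grid of mesh \<open>1 / (n + 1)\<close>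
  gives measurable step functions, and right-continuity makes them converge pointwise to
  \<open>f\<close>.\<close>

lemma right_continuous_borel_measurable:
  fixes f :: "real \<Rightarrow> real"
  assumes "\<And>x. continuous (at_right x) f"
  shows "f \<in> borel_measurable borel"
proof (rule borel_measurable_LIMSEQ_metric)
  \<comment> \<open>Floor plus one instead of the ceiling: the sample point must lie strictly to the
    right of \<open>x\<close> even when \<open>x\<close> is a grid point, since
    \<open>at_right x\<close> excludes \<open>x\<close>.\<close>
  define y where "y n x = (real_of_int \<lfloor>x * real (Suc n)\<rfloor> + 1) / real (Suc n)" for n x
  show "(\<lambda>x. f (y n x)) \<in> borel_measurable borel" for n
  proof -
    \<comment> \<open>The sampled function factors through the integers, where every function is
      measurable.\<close>
    have "(\<lambda>i::int. f ((real_of_int i + 1) / real (Suc n))) \<in> measurable (count_space UNIV) borel"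
      by simp
    moreover have "(\<lambda>x. \<lfloor>x * real (Suc n)\<rfloor>) \<in> measurable borel (count_space UNIV)"
      by measurable
    ultimately show ?thesis
      unfolding y_def by (rule measurable_compose[rotated])
  qed
  show "(\<lambda>n. f (y n x)) \<longlonglongrightarrow> f x" for x
  proof -
    have gt: "x < y n x" for n
    proof -
      have "x * real (Suc n) < real_of_int \<lfloor>x * real (Suc n)\<rfloor> + 1"
        by linarith
      then show ?thesis
        unfolding y_def by (subst pos_less_divide_eq) auto
    qed
    have le: "y n x \<le> x + 1 / real (Suc n)" for n
    proof -
      have "real_of_int \<lfloor>x * real (Suc n)\<rfloor> + 1 \<le> x * real (Suc n) + 1"
        by linarith
      then have "y n x \<le> (x * real (Suc n) + 1) / real (Suc n)"
        unfolding y_def by (intro divide_right_mono) auto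
      also have "\<dots> = x + 1 / real (Suc n)"
        by (simp add: add_divide_distrib)
      finally show ?thesis .
    qed
    have upper: "(\<lambda>n. x + 1 / real (Suc n)) \<longlonglongrightarrow> x"
      using tendsto_add[OF tendsto_const[of x] LIMSEQ_Suc[OF lim_1_over_n[where 'a=real]]] by simp
    have "(\<lambda>n. y n x) \<longlonglongrightarrow> x"
      by (rule tendsto_sandwich[OF _ _ tendsto_const upper])
        (use gt le in \<open>auto intro!: always_eventually less_imp_le\<close>)
    then have "filterlim (\<lambda>n. y n x) (at_right x) sequentially"
      using gt by (simp add: filterlim_at less_imp_neq[symmetric])
    moreover have "(f \<longlongrightarrow> f x) (at_right x)"
      using assms[of x] by (simp add: continuous_within)
    ultimately show ?thesis
      by (rule filterlim_compose[rotated])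
  qed
qed

text \<open>Otherwise some neighbourhood of \<open>L\<close> is missed infinitely often, and
  enumerating the bad indices gives a subsequence none of whose further subsequences tends to
  \<open>L\<close>.\<close>

lemma tendsto_if_subseq_tendsto:
  fixes u :: "nat \<Rightarrow> 'a::topological_space"
  assumes sub: "\<And>k::nat \<Rightarrow> nat. strict_mono k \<Longrightarrow> \<exists>l::nat \<Rightarrow> nat. strict_mono l \<and> (\<lambda>j. u (k (l j))) \<longlonglongrightarrow> L"
  shows "u \<longlonglongrightarrow> L"
proof (rule topological_tendstoI, rule ccontr)
  fix S assume S: "open S" "L \<in> S" "\<not> (\<forall>\<^sub>F n in sequentially. u n \<in> S)"
  then have inf: "infinite {n. u n \<notin> S}"
    by (simp add: cofinite_eq_sequentially[symmetric] eventually_cofinite)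
  define k where "k = enumerate {n. u n \<notin> S}"
  have k: "strict_mono k" "\<And>n. u (k n) \<notin> S"
    using strict_mono_enumerate[OF inf] enumerate_in_set[OF inf] by (auto simp: k_def)
  obtain l where "(\<lambda>j. u (k (l j))) \<longlonglongrightarrow> L"
    using sub[OF k(1)] by blast
  then have "\<forall>\<^sub>F j in sequentially. u (k (l j)) \<in> S"
    using S(1,2) by (rule topological_tendstoD)
  with k(2) show False
    by simp
qed

section \<open>Gaussian measure and the functional \<open>\<rho>\<close>\<close>

text \<open>A finite measure with the Lebesgue null sets, whose density is at most 1 and bounded
  away from 0 on every bounded interval.\<close>

definition gaussian :: "real measure" where
  "gaussian = density lborel std_normal_density"

text \<open>The distance of \<open>g\<close> from 0 in a metric for convergence in measure;
  truncating at 1 keeps the integral finite for every Borel \<open>g\<close>.\<close>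

definition \<rho> :: "(real \<Rightarrow> real) \<Rightarrow> real" where
  "\<rho> g = (\<integral>x. min 1 \<bar>g x\<bar> \<partial>gaussian)"

interpretation gaussian: prob_space gaussian
  unfolding gaussian_def by (rule prob_space_normal_density) simp

lemma sets_gaussian [measurable_cong, simp]: "sets gaussian = sets borel"
  by (simp add: gaussian_def)

lemma space_gaussian [simp]: "space gaussian = UNIV"
  by (simp add: gaussian_def)

text \<open>The density is positive everywhere, and completing \<open>lborel\<close> does not change
  which statements hold almost everywhere.\<close>

lemma AE_gaussian_iff: "(AE x in gaussian. P x) \<longleftrightarrow> (AE x in lebesgue. P x)"
  unfolding gaussian_def AE_completion_iff by (subst AE_density) (auto simp: normal_density_pos)

lemma integrable_truncation:
  assumes [measurable]: "g \<in> borel_measurable borel"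
  shows "integrable gaussian (\<lambda>x. min 1 \<bar>g x :: real\<bar>)"
  by (rule gaussian.integrable_const_bound[where B=1]) auto

text \<open>If the integrand is not integrable, the integral has the default value 0, so this holds
  for every \<open>g\<close>.\<close>

lemma \<rho>_nonneg: "0 \<le> \<rho> g"
  unfolding \<rho>_def by (intro integral_nonneg_AE) auto

text \<open>Dominated convergence with the constant 1, which is integrable for a probability
  measure.\<close>

lemma \<rho>_tendsto_0_if_AE:
  assumes [measurable]: "\<And>n. g n \<in> borel_measurable borel"
    and lim: "AE x in lebesgue. (\<lambda>n. g n x) \<longlonglongrightarrow> 0"
  shows "(\<lambda>n. \<rho> (g n)) \<longlonglongrightarrow> 0"
proof -
  have "(\<lambda>n. \<integral>x. min 1 \<bar>g n x\<bar> \<partial>gaussian) \<longlonglongrightarrow> (\<integral>x. 0 \<partial>gaussian)"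
  proof (rule integral_dominated_convergence[where w="\<lambda>_. 1"])
    show "AE x in gaussian. (\<lambda>n. min 1 \<bar>g n x\<bar>) \<longlonglongrightarrow> 0"
      using lim unfolding AE_gaussian_iff
    proof eventually_elim
      case (elim x)
      have "(\<lambda>n. min 1 \<bar>g n x\<bar>) \<longlonglongrightarrow> min 1 \<bar>0\<bar>"
        by (intro tendsto_intros elim)
      then show ?case by simp
    qed
  qed auto
  then show ?thesis
    by (simp add: \<rho>_def)
qed

lemma AE_subseq_if_\<rho>_tendsto_0:
  assumes [measurable]: "\<And>n. g n \<in> borel_measurable borel"
    and lim: "(\<lambda>n. \<rho> (g n)) \<longlonglongrightarrow> 0"
  obtains l :: "nat \<Rightarrow> nat" where "strict_mono l" "AE x in lebesgue. (\<lambda>j. g (l j) x) \<longlonglongrightarrow> 0"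
proof -
  obtain l :: "nat \<Rightarrow> nat" where l: "strict_mono l"
    and ae: "AE x in gaussian. (\<lambda>j. min 1 \<bar>g (l j) x\<bar>) \<longlonglongrightarrow> 0"
    using tendsto_L1_AE_subseq[of gaussian "\<lambda>n x. min 1 \<bar>g n x\<bar>"] lim integrable_truncation
    by (auto simp: \<rho>_def)
  from ae have "AE x in gaussian. (\<lambda>j. g (l j) x) \<longlonglongrightarrow> 0"
  proof eventually_elim
    case (elim x)
    \<comment> \<open>Removes the truncation: once the truncated value is below 1, it equals
      \<open>\<bar>g (l j) x\<bar>\<close>.\<close>
    have "\<forall>\<^sub>F j in sequentially. min 1 \<bar>g (l j) x\<bar> < 1"
      using elim by (rule order_tendstoD) simp
    then have "\<forall>\<^sub>F j in sequentially. min 1 \<bar>g (l j) x\<bar> = \<bar>g (l j) x\<bar>"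
      by eventually_elim auto
    then have "(\<lambda>j. \<bar>g (l j) x\<bar>) \<longlonglongrightarrow> 0"
      using elim by (rule Lim_transform_eventually[rotated])
    then show ?case
      by (simp add: tendsto_rabs_zero_iff)
  qed
  then show thesis
    using that l by (simp add: AE_gaussian_iff)
qed

section \<open>Comparison with local convergence in Lebesgue measure\<close>

lemma emeasure_gaussian_le_lebesgue:
  assumes [measurable]: "A \<in> sets borel"
  shows "emeasure gaussian A \<le> emeasure lebesgue A"
proof -
  have le1: "std_normal_density x \<le> 1" for x
  proof -
    have "std_normal_density x \<le> 1 / sqrt (2 * pi)"
      unfolding std_normal_density_def by (simp add: divide_le_cancel)
    also have "\<dots> \<le> 1"
      using pi_gt3 by simp
    finally show ?thesis .
  qed
  have "emeasure gaussian A = (\<integral>\<^sup>+ x. ennreal (std_normal_density x) * indicator A x \<partial>lborel)"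
    unfolding gaussian_def by (subst emeasure_density) auto
  also have "\<dots> \<le> (\<integral>\<^sup>+ x. indicator A x \<partial>lborel)"
    using le1 by (intro nn_integral_mono) (auto split: split_indicator)
  also have "\<dots> = emeasure lebesgue A"
    by simp
  finally show ?thesis .
qed

text \<open>On \<open>{-r..r}\<close> the density is smallest at the endpoints.\<close>

lemma lebesgue_le_emeasure_gaussian:
  assumes [measurable]: "A \<in> sets borel" and A: "A \<subseteq> {-r..r}"
  shows "ennreal (std_normal_density r) * emeasure lebesgue A \<le> emeasure gaussian A"
proof -
  have le: "std_normal_density r \<le> std_normal_density x" if "x \<in> A" for x
  proof -
    have "x\<^sup>2 \<le> r\<^sup>2"
      using that A abs_le_square_iff[of x r] by force
    then show ?thesis
      unfolding std_normal_density_def by (intro mult_left_mono) auto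
  qed
  have "ennreal (std_normal_density r) * emeasure lebesgue A
      = (\<integral>\<^sup>+ x. ennreal (std_normal_density r) * indicator A x \<partial>lborel)"
    by (subst nn_integral_cmult_indicator) auto
  also have "\<dots> \<le> (\<integral>\<^sup>+ x. ennreal (std_normal_density x) * indicator A x \<partial>lborel)"
    using le by (intro nn_integral_mono) (auto split: split_indicator intro: ennreal_leI)
  also have "\<dots> = emeasure gaussian A"
    unfolding gaussian_def by (subst emeasure_density) auto
  finally show ?thesis .
qed

text \<open>Markov's inequality for the truncated function, followed by division by the minimum of
  the density. The threshold is \<open>min 1 \<epsilon>\<close> because the truncated function never
  exceeds 1.\<close>

lemma lebesgue_le_\<rho>:
  assumes [measurable]: "g \<in> borel_measurable borel" and "\<epsilon> > 0"
  shows "emeasure lebesgue {x \<in> {-r..r}. \<bar>g x\<bar> > \<epsilon>}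
    \<le> ennreal (\<rho> g / (min 1 \<epsilon> * std_normal_density r))"
proof -
  let ?A = "{x \<in> {-r..r}. \<bar>g x\<bar> > \<epsilon>}" and ?w = "std_normal_density r"
  have w: "0 < ?w"
    by (simp add: normal_density_pos)
  have [measurable]: "?A \<in> sets borel"
    by measurable
  have "ennreal ?w * emeasure lebesgue ?A \<le> emeasure gaussian ?A"
    by (rule lebesgue_le_emeasure_gaussian) auto
  also have "\<dots> \<le> emeasure gaussian {x \<in> space gaussian. min 1 \<bar>g x\<bar> \<ge> min 1 \<epsilon>}"
    by (rule emeasure_mono) auto
  also have "\<dots> \<le> ennreal (1 / min 1 \<epsilon> * \<rho> g)"
    unfolding \<rho>_def
    by (rule integral_Markov_inequality) (use \<open>\<epsilon> > 0\<close> integrable_truncation in auto)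
  finally have "ennreal (1 / ?w) * (ennreal ?w * emeasure lebesgue ?A)
      \<le> ennreal (1 / ?w) * ennreal (1 / min 1 \<epsilon> * \<rho> g)"
    by (rule mult_left_mono) simp
  moreover have "ennreal (1 / ?w) * (ennreal ?w * emeasure lebesgue ?A) = emeasure lebesgue ?A"
    using w by (simp add: mult.assoc[symmetric] ennreal_mult[symmetric])
  moreover have "ennreal (1 / ?w) * ennreal (1 / min 1 \<epsilon> * \<rho> g) = ennreal (\<rho> g / (min 1 \<epsilon> * ?w))"
    using w by (simp add: ennreal_mult'[symmetric] mult.commute)
  ultimately show ?thesis
    by simp
qed

text \<open>The integrand is at most 1 outside the interval and where \<open>\<bar>g x\<bar>\<close>
  exceeds \<open>\<epsilon>\<close>, and at most \<open>\<epsilon>\<close> elsewhere.\<close>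

lemma \<rho>_le_measure:
  assumes [measurable]: "g \<in> borel_measurable borel" and "\<epsilon> \<ge> 0"
  shows "\<rho> g \<le> measure gaussian (- {-r..r}) + \<epsilon> + measure gaussian {x \<in> {-r..r}. \<bar>g x\<bar> > \<epsilon>}"
proof -
  let ?A = "{x \<in> {-r..r}. \<bar>g x\<bar> > \<epsilon>}" and ?B = "- {-r..r}"
  have "\<rho> g \<le> (\<integral>x. indicator ?B x + \<epsilon> + indicator ?A x \<partial>gaussian)"
    unfolding \<rho>_def using \<open>\<epsilon> \<ge> 0\<close> integrable_truncation
    by (intro integral_mono) (auto split: split_indicator simp: gaussian.emeasure_eq_measure)
  also have "\<dots> = measure gaussian ?B + \<epsilon> + measure gaussian ?A"
    by (simp add: gaussian.emeasure_eq_measure gaussian.prob_space[simplified])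
  finally show ?thesis .
qed

text \<open>Continuity from above of a finite measure along sets decreasing to the empty
  set.\<close>

lemma measure_gaussian_tail: "(\<lambda>m. measure gaussian (- {- real m..real m})) \<longlonglongrightarrow> 0"
proof -
  have "\<exists>m. x \<in> {- real m..real m}" for x
    using real_arch_simple[of "\<bar>x\<bar>"] by (simp add: abs_le_iff) (meson minus_le_iff)
  then have "(\<Inter>m. - {- real m..real m}) = {}"
    by blast
  moreover have "(\<lambda>m. measure gaussian (- {- real m..real m}))
      \<longlonglongrightarrow> measure gaussian (\<Inter>m. - {- real m..real m})"
    by (rule gaussian.finite_Lim_measure_decseq) (auto simp: decseq_def)
  ultimately show ?thesis
    by simp
qed

lemma locally_in_measure_iff_\<rho>:
  assumes [measurable]: "\<And>n. g n \<in> borel_measurable borel"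
  shows "(\<forall>\<epsilon>>0. \<forall>r>0. (\<lambda>n. emeasure lebesgue {x \<in> {-r..r}. \<bar>g n x\<bar> > \<epsilon>}) \<longlonglongrightarrow> 0)
    \<longleftrightarrow> (\<lambda>n. \<rho> (g n)) \<longlonglongrightarrow> 0"
proof (intro iffI allI impI)
  fix \<epsilon> r :: real
  assume lim: "(\<lambda>n. \<rho> (g n)) \<longlonglongrightarrow> 0" and "\<epsilon> > 0"
  have "(\<lambda>n. \<rho> (g n) / (min 1 \<epsilon> * std_normal_density r)) \<longlonglongrightarrow> 0"
    using lim by (rule tendsto_divide_zero)
  then have "(\<lambda>n. ennreal (\<rho> (g n) / (min 1 \<epsilon> * std_normal_density r))) \<longlonglongrightarrow> 0"
    using tendsto_ennrealI by fastforce
  then show "(\<lambda>n. emeasure lebesgue {x \<in> {-r..r}. \<bar>g n x\<bar> > \<epsilon>}) \<longlonglongrightarrow> 0"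
    by (rule tendsto_sandwich[OF _ _ tendsto_const, rotated 2])
      (use \<open>\<epsilon> > 0\<close> lebesgue_le_\<rho> in \<open>auto intro!: always_eventually\<close>)
next
  assume meas: "\<forall>\<epsilon>>0. \<forall>r>0. (\<lambda>n. emeasure lebesgue {x \<in> {-r..r}. \<bar>g n x\<bar> > \<epsilon>}) \<longlonglongrightarrow> 0"
  show "(\<lambda>n. \<rho> (g n)) \<longlonglongrightarrow> 0"
  proof (rule order_tendstoI)
    fix a :: real assume "a < 0"
    then show "\<forall>\<^sub>F n in sequentially. a < \<rho> (g n)"
      using \<rho>_nonneg by (auto intro!: always_eventually elim: less_le_trans)
  next
    fix a :: real assume "0 < a"
    \<comment> \<open>One third for each summand in \<open>\<rho>_le_measure\<close>: the tail, the
      level \<open>\<epsilon>\<close> and the set where \<open>\<bar>g n x\<bar>\<close> exceeds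
      it.\<close>
    define \<epsilon> where "\<epsilon> = a / 3"
    have \<epsilon>: "\<epsilon> > 0"
      using \<open>0 < a\<close> by (simp add: \<epsilon>_def)
    \<comment> \<open>The condition \<open>0 < m\<close> lets \<open>m\<close> serve as the radius
      \<open>r > 0\<close> in \<open>meas\<close>.\<close>
    have "\<forall>\<^sub>F m in sequentially. measure gaussian (- {- real m..real m}) < \<epsilon> \<and> 0 < m"
      using order_tendstoD(2)[OF measure_gaussian_tail \<epsilon>] eventually_gt_at_top
      by (rule eventually_conj)
    then obtain m :: nat where m: "measure gaussian (- {- real m..real m}) < \<epsilon>" "0 < m"
      by (auto simp: eventually_sequentially)
    have "(\<lambda>n. emeasure lebesgue {x \<in> {- real m..real m}. \<bar>g n x\<bar> > \<epsilon>}) \<longlonglongrightarrow> 0"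
      using meas \<epsilon> m(2) by simp
    then have "\<forall>\<^sub>F n in sequentially.
        emeasure lebesgue {x \<in> {- real m..real m}. \<bar>g n x\<bar> > \<epsilon>} < ennreal \<epsilon>"
      using \<epsilon> by (auto elim: order_tendstoD)
    then show "\<forall>\<^sub>F n in sequentially. \<rho> (g n) < a"
    proof eventually_elim
      case (elim n)
      let ?A = "{x \<in> {- real m..real m}. \<bar>g n x\<bar> > \<epsilon>}"
      have "emeasure gaussian ?A \<le> emeasure lebesgue ?A"
        by (rule emeasure_gaussian_le_lebesgue) measurable
      also note elim
      finally have "measure gaussian ?A < \<epsilon>"
        by (simp add: gaussian.emeasure_eq_measure ennreal_less_iff)
      with m \<rho>_le_measure[of "g n" \<epsilon> "real m"] \<epsilon> show ?case
        by (simp add: \<epsilon>_def)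
    qed
  qed
qed

section \<open>Choice of the constants\<close>

text \<open>Since \<open>\<rho>\<close> is bounded below by 0, the infimum over all constants is
  finite; the slack \<open>\<eta>\<close> avoids showing that it is attained.\<close>

lemma near_minimiser_of_\<rho>:
  assumes "\<eta> > 0"
  obtains c where "\<And>c'. \<rho> (\<lambda>x. g x - c) \<le> \<rho> (\<lambda>x. g x - c') + \<eta>"
proof -
  let ?R = "range (\<lambda>c. \<rho> (\<lambda>x. g x - c))"
  have bdd: "bdd_below ?R"
    by (intro bdd_belowI[of _ 0]) (auto simp: \<rho>_nonneg)
  have "Inf ?R < Inf ?R + \<eta>"
    using assms by simp
  then obtain c where c: "\<rho> (\<lambda>x. g x - c) < Inf ?R + \<eta>"
    using cInf_lessD[of ?R] by blast
  have "Inf ?R \<le> \<rho> (\<lambda>x. g x - c')" for c'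
    using bdd by (rule cInf_lower[rotated]) simp
  with c have "\<rho> (\<lambda>x. g x - c) \<le> \<rho> (\<lambda>x. g x - c') + \<eta>" for c'
    using less_imp_le order_trans add_right_mono by meson
  then show thesis
    by (rule that)
qed

lemma \<rho>_tendsto_0_if_converges_almost_basically:
  assumes [measurable]: "\<And>n. fs n \<in> borel_measurable borel" "f \<in> borel_measurable borel"
    and conv: "converges_almost_basically fs f"
  obtains c where "(\<lambda>n. \<rho> (\<lambda>x. fs n x - c n - f x)) \<longlonglongrightarrow> 0"
proof -
  have "\<exists>c. \<forall>c'. \<rho> (\<lambda>x. (fs n x - f x) - c) \<le> \<rho> (\<lambda>x. (fs n x - f x) - c') + 1 / real (Suc n)" for n
    by (rule near_minimiser_of_\<rho>[of "1 / real (Suc n)" "\<lambda>x. fs n x - f x"]) auto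
  then obtain c where c: "\<rho> (\<lambda>x. (fs n x - f x) - c n)
      \<le> \<rho> (\<lambda>x. (fs n x - f x) - c') + 1 / real (Suc n)" for n c'
    by metis
  have "(\<lambda>n. \<rho> (\<lambda>x. (fs n x - f x) - c n)) \<longlonglongrightarrow> 0"
  proof (rule tendsto_if_subseq_tendsto)
    fix k :: "nat \<Rightarrow> nat" assume k: "strict_mono k"
    obtain l S where l: "strict_mono l" and S: "S \<in> null_sets lebesgue"
      and lim: "\<And>x1 x2. x1 \<in> - S \<Longrightarrow> x2 \<in> - S \<Longrightarrow>
        (\<lambda>j. fs (k (l j)) x1 - fs (k (l j)) x2) \<longlonglongrightarrow> f x1 - f x2"
      using conv k unfolding converges_almost_basically_def by meson
    \<comment> \<open>The whole line is not a null set, so a reference point outside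
      \<open>S\<close> exists.\<close>
    have "S \<noteq> UNIV"
      using S by (auto simp: null_sets_def)
    then obtain x0 where x0: "x0 \<in> - S"
      by blast
    define c' where "c' j = fs (k (l j)) x0 - f x0" for j
    have "(\<lambda>j. \<rho> (\<lambda>x. (fs (k (l j)) x - f x) - c' j)) \<longlonglongrightarrow> 0"
    proof (rule \<rho>_tendsto_0_if_AE)
      show "AE x in lebesgue. (\<lambda>j. (fs (k (l j)) x - f x) - c' j) \<longlonglongrightarrow> 0"
        using AE_not_in[OF S]
      proof eventually_elim
        case (elim x)
        \<comment> \<open>Regrouped, this is the error \<open>(fs (k (l j)) x - f x) - c' j\<close>
          of the competitor.\<close>
        have "(\<lambda>j. (fs (k (l j)) x - fs (k (l j)) x0) - (f x - f x0)) \<longlonglongrightarrow> (f x - f x0) - (f x - f x0)"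
          using elim x0 by (intro tendsto_diff lim tendsto_const) auto
        then show ?case
          by (simp add: c'_def algebra_simps)
      qed
    qed measurable
    moreover have "(\<lambda>j. 1 / real (Suc (k (l j)))) \<longlonglongrightarrow> 0"
      using LIMSEQ_subseq_LIMSEQ[OF LIMSEQ_Suc[OF lim_1_over_n[where 'a=real]]
          strict_mono_o[OF k l]] by (simp add: comp_def)
    ultimately have "(\<lambda>j. \<rho> (\<lambda>x. (fs (k (l j)) x - f x) - c' j) + 1 / real (Suc (k (l j)))) \<longlonglongrightarrow> 0"
      by (rule tendsto_add_zero)
    then have "(\<lambda>j. \<rho> (\<lambda>x. (fs (k (l j)) x - f x) - c (k (l j)))) \<longlonglongrightarrow> 0"
      by (rule tendsto_sandwich[OF _ _ tendsto_const, rotated 2])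
        (use c \<rho>_nonneg in \<open>auto intro!: always_eventually\<close>)
    with l show "\<exists>l. strict_mono l \<and> (\<lambda>j. \<rho> (\<lambda>x. (fs (k (l j)) x - f x) - c (k (l j)))) \<longlonglongrightarrow> 0"
      by blast
  qed
  then show thesis
    by (intro that[of c]) (simp add: algebra_simps)
qed

section \<open>The cycle of implications from (i) through (ii) and (iii) back to (i)\<close>

theorem theorem3p8:
  fixes fs :: "nat \<Rightarrow> real \<Rightarrow> real" and f :: "real \<Rightarrow> real"
  assumes "\<And>n. fs n \<in> \<W>" and "f \<in> \<W>"
  shows "(converges_almost_basically fs f \<longleftrightarrow> converges_locally_in_measure_upto_constants fs f) \<and>
         (converges_locally_in_measure_upto_constants fs f \<longleftrightarrow>
           (\<exists>c::nat \<Rightarrow> real. \<forall>k::nat \<Rightarrow> nat. strict_mono k \<longrightarrow>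
             (\<exists>l::nat \<Rightarrow> nat. strict_mono l \<and>
               (\<exists>S. S \<in> sets borel \<and> emeasure lebesgue S = 0 \<and>
                 (\<forall>x \<in> - S. (\<lambda>j. fs (k (l j)) x - c (k (l j))) \<longlonglongrightarrow> f x)))))"
    (is "(?i \<longleftrightarrow> ?ii) \<and> (_ \<longleftrightarrow> ?iii)")
proof -
  have [measurable]: "fs n \<in> borel_measurable borel" "f \<in> borel_measurable borel" for n
    using assms by (auto simp: \<W>_def intro: right_continuous_borel_measurable)
  have ii_iff: "?ii \<longleftrightarrow> (\<exists>c. (\<lambda>n. \<rho> (\<lambda>x. fs n x - c n - f x)) \<longlonglongrightarrow> 0)"
    unfolding converges_locally_in_measure_upto_constants_def
    by (subst locally_in_measure_iff_\<rho>) auto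
  have ?ii if ?i
    unfolding ii_iff by (rule \<rho>_tendsto_0_if_converges_almost_basically[OF _ _ that]) auto
  moreover have ?iii if ?ii
  proof -
    obtain c where c: "(\<lambda>n. \<rho> (\<lambda>x. fs n x - c n - f x)) \<longlonglongrightarrow> 0"
      using \<open>?ii\<close> unfolding ii_iff by blast
    show ?iii
    proof (intro exI[of _ c] allI impI)
      fix k :: "nat \<Rightarrow> nat" assume "strict_mono k"
      then have "(\<lambda>n. \<rho> (\<lambda>x. fs (k n) x - c (k n) - f x)) \<longlonglongrightarrow> 0"
        using LIMSEQ_subseq_LIMSEQ[OF c] by (simp add: comp_def)
      then obtain l :: "nat \<Rightarrow> nat" where l: "strict_mono l"
        and ae: "AE x in lebesgue. (\<lambda>j. fs (k (l j)) x - c (k (l j)) - f x) \<longlonglongrightarrow> 0"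
        by (rule AE_subseq_if_\<rho>_tendsto_0[rotated]) auto
      \<comment> \<open>Passing from \<open>lebesgue\<close> to \<open>lborel\<close> ensures that
        the exceptional set can be taken Borel, as (iii) demands.\<close>
      from ae have "AE x in lborel. (\<lambda>j. fs (k (l j)) x - c (k (l j))) \<longlonglongrightarrow> f x"
        by (simp add: AE_completion_iff LIM_zero_iff)
      then obtain S where "S \<in> null_sets lborel"
        and "{x. \<not> (\<lambda>j. fs (k (l j)) x - c (k (l j))) \<longlonglongrightarrow> f x} \<subseteq> S"
        by (auto simp: eventually_ae_filter)
      then have "S \<in> sets borel \<and> emeasure lebesgue S = 0 \<and>
          (\<forall>x \<in> - S. (\<lambda>j. fs (k (l j)) x - c (k (l j))) \<longlonglongrightarrow> f x)"
        by (auto simp: null_sets_def)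
      with l show "\<exists>l. strict_mono l \<and> (\<exists>S. S \<in> sets borel \<and> emeasure lebesgue S = 0 \<and>
          (\<forall>x \<in> - S. (\<lambda>j. fs (k (l j)) x - c (k (l j))) \<longlonglongrightarrow> f x))"
        by blast
    qed
  qed
  moreover have ?i if iii: ?iii
    unfolding converges_almost_basically_def
  proof (intro allI impI)
    obtain c where c: "\<And>k. strict_mono k \<Longrightarrow> \<exists>l::nat \<Rightarrow> nat. strict_mono l \<and>
        (\<exists>S. S \<in> sets borel \<and> emeasure lebesgue S = 0 \<and>
          (\<forall>x \<in> - S. (\<lambda>j. fs (k (l j)) x - c (k (l j))) \<longlonglongrightarrow> f x))"
      using iii by blast
    fix k :: "nat \<Rightarrow> nat" assume "strict_mono k"
    then obtain l S where l: "strict_mono l" and S: "S \<in> sets borel" "emeasure lebesgue S = 0"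
      and lim: "\<And>x. x \<in> - S \<Longrightarrow> (\<lambda>j. fs (k (l j)) x - c (k (l j))) \<longlonglongrightarrow> f x"
      using c by meson
    \<comment> \<open>The constants \<open>c (k (l j))\<close> cancel in the difference of the
      values at two points.\<close>
    have "(\<lambda>j. fs (k (l j)) x1 - fs (k (l j)) x2) \<longlonglongrightarrow> f x1 - f x2"
      if "x1 \<in> - S" "x2 \<in> - S" for x1 x2
      using tendsto_diff[OF lim[OF that(1)] lim[OF that(2)]] by simp
    moreover have "S \<in> null_sets lebesgue"
      using S by (auto simp: null_sets_def)
    ultimately show "\<exists>l. strict_mono l \<and> (\<exists>S \<in> null_sets lebesgue. \<forall>x\<^sub>1 \<in> - S. \<forall>x\<^sub>2 \<in> - S.
        (\<lambda>j. fs (k (l j)) x\<^sub>1 - fs (k (l j)) x\<^sub>2) \<longlonglongrightarrow> f x\<^sub>1 - f x\<^sub>2)"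
      using l by blast
  qed
  ultimately show ?thesis
    by blast
qed

end
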